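(* For each $N\ge3$, the set of length-$N$ partial flag varieties admitting at least one non-exceeding semiclassical spectrum has density zero, that is $$\lim_{n\to\infty}\frac{\#\Bigl\{F_{\boldsymbol\lambda}:\ \boldsymbol\lambda\in\mathbb Z_{>0}^N,\ \sum_{a=1}^N\lambda_a\le n,\ F_{\boldsymbol\lambda}\text{ admits at least one non-exceeding semiclassical spectrum}\Bigr\}}{\#\Bigl\{F_{\boldsymbol\lambda}:\ \boldsymbol\lambda\in\mathbb Z_{>0}^N,\ \sum_{a=1}^N\lambda_a\le n\Bigr\}}=0.$$
   Context: For $\boldsymbol\lambda=(\lambda_1,\dots,\lambda_N)\in\mathbb Z_{>0}^N$ with $|\boldsymbol\lambda|=\sum_a\lambda_a=m$, $F_{\boldsymbol\lambda}$ is the variety of flags $0=V_0\subset V_1\subset\dots\subset V_N=\mathbb C^m$ with $\dim(V_i/V_{i-1})=\lambda_i$; in the counts above, the $F_{\boldsymbol\lambda}$ are indexed by the tuples $\boldsymbol\lambda$. For $i=1,\dots,N-1$, the $i$-th semiclassical spectrum of $F_{\boldsymbol\lambda}$ is the spectrum of the limit, as $q_j\to0$ for all $j\ne i$, of the operator of small quantum multiplication by $c_1(F_{\boldsymbol\lambda})$ on $H^\bullet(F_{\boldsymbol\lambda},\mathbb C)$; it is called exceeding if some eigenvalue has algebraic multiplicity strictly greater than $\frac{m!}{\lambda_1!\cdots\lambda_{i-1}!(\lambda_i+\lambda_{i+1})!\lambda_{i+2}!\cdots\lambda_N!}$ (the minimal possible multiplicity), and non-exceeding otherwise. Combinatorially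 (this may be taken as the definition): the $i$-th semiclassical spectrum is non-exceeding if and only if $\min\{\lambda_i,\lambda_{i+1}\}<p_1(\lambda_i+\lambda_{i+1})$, where $p_1(m)$ denotes the smallest prime divisor of $m\ge2$. *)

theory Defs
  imports Complex_Main "HOL-Computational_Algebra.Primes"
begin

text \<open>
  A partial flag variety $F_{\lambda}$ of length $N$ is represented by its index, the tuple
  $\lambda = (\lambda_1, \ldots, \lambda_N)$ of positive integers, encoded as a list of
  length \<open>N\<close>. Flag varieties are counted by tuples, so two lists that differ by a
  permutation are counted separately. Lists are indexed from 0: the entry $\lambda_a$ is
  \<open>l ! (a - 1)\<close>.
\<close>

definition flag_types :: "nat \<Rightarrow> nat list set" where
  "flag_types N = {l. length l = N \<and> (\<forall>x \<in> set l. 0 < x)}"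

definition flag_types_upto :: "nat \<Rightarrow> nat \<Rightarrow> nat list set" where
  "flag_types_upto N n = {l \<in> flag_types N. sum_list l \<le> n}"

text \<open>Only meaningful for \<open>m \<ge> 2\<close>.\<close>

definition smallest_prime_divisor :: "nat \<Rightarrow> nat" where
  "smallest_prime_divisor m = (LEAST p. prime p \<and> p dvd m)"

text \<open>
  The \<open>i\<close>-th semiclassical spectrum of $F_{\lambda}$ ($1 \le i \le N - 1$) is the spectrum
  of the limit, as $q_j \to 0$ for all $j \ne i$, of small quantum multiplication by
  $c_1(F_{\lambda})$. Its being non-exceeding (no eigenvalue has algebraic multiplicity larger
  than the minimal possible one) is taken here in its combinatorial form
  $\min \{\lambda_i, \lambda_{i+1}\} < p_1(\lambda_i + \lambda_{i+1})$.
\<close>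

definition non_exceeding :: "nat list \<Rightarrow> nat \<Rightarrow> bool" where
  "non_exceeding l i \<longleftrightarrow>
     min (l ! (i - 1)) (l ! i) < smallest_prime_divisor (l ! (i - 1) + l ! i)"

definition admits_non_exceeding :: "nat list \<Rightarrow> bool" where
  "admits_non_exceeding l \<longleftrightarrow> (\<exists>i \<in> {1..length l - 1}. non_exceeding l i)"

end

theory Submission
  imports Defs
begin

text \<open>
  A pair \<open>(a, b)\<close> of neighbouring entries gives a non-exceeding spectrum only in two rare
  situations. If \<open>a + b\<close> is composite, its smallest prime divisor is at most \<open>sqrt (a + b)\<close>, so
  \<open>min a b\<close> must lie below that square root: among the pairs with \<open>a + b \<le> n\<close> this leaves at
  most \<open>2 * n * sqrt n\<close>. If \<open>a + b\<close> is prime, the pair is determined by \<open>a\<close> and that prime,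
  so there are at most \<open>n * \<pi>(n)\<close> such pairs, where \<open>\<pi>(n)\<close> is the number of primes up to \<open>n\<close>.
  Since \<open>\<pi>(n) = o(n)\<close>, altogether only \<open>o(n ^ 2)\<close> pairs qualify
  (\<open>non_exceeding_pairs_density_zero\<close>).

  The passage from pairs to tuples is a crude count. A tuple of sum at most \<open>n\<close> that is
  non-exceeding at a given place consists of one of these pairs and \<open>N - 2\<close> further entries from
  \<open>{1..n}\<close>, which makes \<open>n ^ (N - 2) * o(n ^ 2) = o(n ^ N)\<close> tuples
  (\<open>card_flag_types_upto_non_exceeding_at_le\<close>), and there are only \<open>N - 1\<close> places. In contrast,
  all tuples with entries up to \<open>n div N\<close> have sum at most \<open>n\<close>, so the denominator has the full
  order \<open>n ^ N\<close> (\<open>card_flag_types_upto_ge\<close>).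

  The estimate \<open>\<pi>(n) = o(n)\<close> comes from the Erdos bound \<open>4 ^ n\<close> for the product of the primes
  up to \<open>n\<close>: the primes exceeding \<open>sqrt n\<close> contribute more than \<open>sqrt n\<close> each to this product,
  hence their number is \<open>O(n / ln n)\<close>.
\<close>

section \<open>From tuples to pairs of neighbouring entries\<close>

definition non_exceeding_pairs :: "nat \<Rightarrow> (nat \<times> nat) set" where
  "non_exceeding_pairs n =
     {(a, b). 0 < a \<and> 0 < b \<and> a + b \<le> n \<and> min a b < smallest_prime_divisor (a + b)}"

lemma finite_non_exceeding_pairs: "finite (non_exceeding_pairs n)"
proof (rule finite_subset)
  show "non_exceeding_pairs n \<subseteq> {..n} \<times> {..n}"
    unfolding non_exceeding_pairs_def by auto
qed simp

text \<open>
  The cube of tuples with all entries in \<open>{1..n div N}\<close> lies inside the simplex of tuples with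
  sum at most \<open>n\<close>.
\<close>
lemma card_flag_types_upto_ge:
  "(n div N) ^ N \<le> card (flag_types_upto N n)"
proof -
  have "{l. set l \<subseteq> {1..n div N} \<and> length l = N} \<subseteq> flag_types_upto N n"
  proof (safe)
    fix l :: "nat list" assume l: "set l \<subseteq> {1..n div length l}" "N = length l"
    have "sum_list l \<le> length l * (n div length l)"
      using l sum_list_mono[of l "\<lambda>x. x" "\<lambda>_. n div length l"]
      by (simp add: sum_list_triv subset_iff)
    also have "\<dots> \<le> n" by simp
    finally show "l \<in> flag_types_upto (length l) n"
      using l by (auto simp: flag_types_upto_def flag_types_def)
  qed
  moreover have "finite (flag_types_upto N n)"
  proof (rule finite_subset)
    show "flag_types_upto N n \<subseteq> {l. set l \<subseteq> {..n} \<and> length l = N}"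
      by (auto simp: flag_types_upto_def flag_types_def dest: member_le_sum_list)
  qed (simp add: finite_lists_length_eq)
  ultimately have "card {l. set l \<subseteq> {1..n div N} \<and> length l = N} \<le> card (flag_types_upto N n)"
    by (intro card_mono)
  then show ?thesis by (simp add: card_lists_length_eq)
qed

text \<open>For \<open>n \<ge> N\<close> the rounding in \<open>n div N\<close> costs at most a factor of two.\<close>
lemma card_flag_types_upto_ge_power:
  assumes "0 < N" "N \<le> n"
  shows "(real n / (2 * real N)) ^ N \<le> real (card (flag_types_upto N n))"
proof -
  have "n div N \<ge> 1" using assms by (simp add: Suc_le_eq div_greater_zero_iff)
  then have "N \<le> N * (n div N)" by simp
  moreover have "n mod N < N" "n = N * (n div N) + n mod N" using assms by simp_all
  ultimately have "n \<le> 2 * N * (n div N)" by linarith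
  then have "real n \<le> real (2 * N * (n div N))" by (simp only: of_nat_le_iff)
  then have "real n / (2 * real N) \<le> real (n div N)"
    using assms by (simp add: field_simps)
  then have "(real n / (2 * real N)) ^ N \<le> real (n div N) ^ N"
    by (rule power_mono) simp
  also have "\<dots> = real ((n div N) ^ N)" by simp
  also have "\<dots> \<le> real (card (flag_types_upto N n))"
    by (simp only: of_nat_le_iff card_flag_types_upto_ge)
  finally show ?thesis .
qed

lemma list_eq_take_pair_drop:
  assumes "1 \<le> i" "i < length l"
  shows "l = take (i - 1) l @ l ! (i - 1) # l ! i # drop (i + 1) l"
proof -
  have "i - 1 < length l" "Suc (i - 1) = i" using assms by auto
  with id_take_nth_drop[of "i - 1" l] Cons_nth_drop_Suc[OF assms(2)] show ?thesis by simp
qed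

text \<open>
  Cut the tuple around the pair at place \<open>i\<close>: only the pair has to satisfy the arithmetic
  condition, and each of the other \<open>N - 2\<close> entries has at most \<open>n\<close> choices.
\<close>
lemma card_flag_types_upto_non_exceeding_at_le:
  assumes "i \<in> {1..N - 1}"
  shows "card {l \<in> flag_types_upto N n. non_exceeding l i}
           \<le> n ^ (N - 2) * card (non_exceeding_pairs n)"
proof -
  let ?W = "\<lambda>k. {l. set l \<subseteq> {1..n} \<and> length l = k}"
  let ?D = "?W (i - 1) \<times> non_exceeding_pairs n \<times> ?W (N - i - 1)"
  let ?f = "\<lambda>(xs, (a, b), ys). xs @ a # b # ys"
  have "{l \<in> flag_types_upto N n. non_exceeding l i} \<subseteq> ?f ` ?D"
  proof (rule subsetI)
    fix l assume "l \<in> {l \<in> flag_types_upto N n. non_exceeding l i}"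
    then have l: "length l = N" "\<forall>x\<in>set l. 0 < x" "sum_list l \<le> n" "non_exceeding l i"
      by (auto simp: flag_types_upto_def flag_types_def)
    define xs ys where "xs = take (i - 1) l" and "ys = drop (i + 1) l"
    have "1 \<le> i" "i < length l" using assms l(1) by auto
    then have split: "l = xs @ l ! (i - 1) # l ! i # ys"
      unfolding xs_def ys_def by (rule list_eq_take_pair_drop)
    have sum: "sum_list xs + (l ! (i - 1) + (l ! i + sum_list ys)) \<le> n"
      using l(3) by (subst (asm) split) simp
    have "set l \<subseteq> {1..n}"
      using l member_le_sum_list[of _ l] by (force simp: Suc_le_eq)
    then have "set xs \<subseteq> {1..n}" "set ys \<subseteq> {1..n}"
      using set_take_subset set_drop_subset unfolding xs_def ys_def by fast+
    moreover have "length xs = i - 1" "length ys = N - i - 1"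
      using assms l(1) by (auto simp: xs_def ys_def)
    moreover have "(l ! (i - 1), l ! i) \<in> non_exceeding_pairs n"
    proof -
      have "i - 1 < length l" "i < length l" using \<open>i < length l\<close> by auto
      then have "0 < l ! (i - 1)" "0 < l ! i" using l(2) nth_mem by blast+
      then show ?thesis
        using l(4) sum by (simp add: non_exceeding_pairs_def non_exceeding_def)
    qed
    ultimately have "(xs, (l ! (i - 1), l ! i), ys) \<in> ?D" by simp
    then show "l \<in> ?f ` ?D" by (rule rev_image_eqI) (use split in simp)
  qed
  moreover have fin: "finite ?D"
    by (simp add: finite_lists_length_eq finite_non_exceeding_pairs)
  ultimately have "card {l \<in> flag_types_upto N n. non_exceeding l i} \<le> card (?f ` ?D)"
    by (intro card_mono) auto
  also have "\<dots> \<le> card ?D" using fin by (rule card_image_le)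
  also have "\<dots> = n ^ ((i - 1) + (N - i - 1)) * card (non_exceeding_pairs n)"
    by (simp add: card_cartesian_product card_lists_length_eq power_add)
  also have "(i - 1) + (N - i - 1) = N - 2" using assms by auto
  finally show ?thesis .
qed

lemma card_flag_types_upto_admits_non_exceeding_le:
  "card {l \<in> flag_types_upto N n. admits_non_exceeding l}
     \<le> (N - 1) * (n ^ (N - 2) * card (non_exceeding_pairs n))"
proof -
  have "{l \<in> flag_types_upto N n. admits_non_exceeding l}
          = (\<Union>i\<in>{1..N - 1}. {l \<in> flag_types_upto N n. non_exceeding l i})"
    by (auto simp: admits_non_exceeding_def flag_types_upto_def flag_types_def)
  also have "card \<dots> \<le> (\<Sum>i\<in>{1..N - 1}. card {l \<in> flag_types_upto N n. non_exceeding l i})"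
    by (rule card_UN_le) simp
  also have "\<dots> \<le> (\<Sum>i\<in>{1..N - 1}. n ^ (N - 2) * card (non_exceeding_pairs n))"
    by (intro sum_mono card_flag_types_upto_non_exceeding_at_le)
  finally show ?thesis by simp
qed

text \<open>The factor \<open>N - 1\<close> counts the places at which a tuple may be non-exceeding.\<close>
lemma admits_non_exceeding_ratio_le:
  assumes "2 \<le> N" "N \<le> n"
  shows "real (card {l \<in> flag_types_upto N n. admits_non_exceeding l})
             / real (card (flag_types_upto N n))
           \<le> real (N - 1) * (2 * real N) ^ N * (real (card (non_exceeding_pairs n)) / real n ^ 2)"
proof -
  let ?B = "real (card (non_exceeding_pairs n))"
  have n: "0 < real n" using assms by simp
  have "real (card {l \<in> flag_types_upto N n. admits_non_exceeding l})
          \<le> real ((N - 1) * (n ^ (N - 2) * card (non_exceeding_pairs n)))"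
    by (simp only: of_nat_le_iff card_flag_types_upto_admits_non_exceeding_le)
  then have "real (card {l \<in> flag_types_upto N n. admits_non_exceeding l})
               / real (card (flag_types_upto N n))
             \<le> real ((N - 1) * (n ^ (N - 2) * card (non_exceeding_pairs n)))
               / (real n / (2 * real N)) ^ N"
    using card_flag_types_upto_ge_power[of N n] n assms by (intro frac_le) auto
  also have "\<dots> = real (N - 1) * (2 * real N) ^ N * (?B / real n ^ 2)"
  proof -
    have "N - 2 + 2 = N" using assms by simp
    with power_add[of "real n" "N - 2" 2]
    have "real n ^ N = real n ^ (N - 2) * real n ^ 2" by (simp only:)
    then show ?thesis using n assms by (simp add: field_simps)
  qed
  finally show ?thesis .
qed

section \<open>The primes have density zero\<close>

text \<open>
  The binomial coefficient occurs twice, by symmetry, in its row of Pascal's triangle, whose sum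
  is \<open>2 * 4 ^ m\<close>.
\<close>
lemma odd_central_binomial_le: "(2 * m + 1) choose m \<le> 4 ^ m"
proof -
  have "2 * ((2 * m + 1) choose m) = (\<Sum>k\<in>{m, m + 1}. (2 * m + 1) choose k)"
    using binomial_symmetric[of m "2 * m + 1"] by simp
  also have "\<dots> \<le> (\<Sum>k\<le>2 * m + 1. (2 * m + 1) choose k)"
    by (rule sum_mono2) auto
  also have "\<dots> = 2 * 4 ^ m"
    by (simp only: choose_row_sum) (simp add: power_mult)
  finally show ?thesis by simp
qed

lemma prod_primes_dvd:
  fixes S :: "nat set"
  assumes "finite S" and "\<And>p. p \<in> S \<Longrightarrow> prime p" and "\<And>p. p \<in> S \<Longrightarrow> p dvd k"
  shows "\<Prod>S dvd k"
  using assms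
proof (induction S rule: finite_induct)
  case (insert p S)
  have "coprime p (\<Prod>S)"
    using insert by (intro prod_coprime_right) (auto intro!: primes_coprime)
  with insert show ?case by (auto intro: divides_mult)
qed simp

text \<open>
  Such a prime occurs in the numerator of \<open>(2 * m + 1)! / (m! * (m + 1)!)\<close> but not in the
  denominator.
\<close>
lemma prime_dvd_odd_central_binomial:
  assumes "prime p" "m + 1 < p" "p \<le> 2 * m + 1"
  shows "p dvd (2 * m + 1) choose m"
proof -
  have "fact m * fact (m + 1) * ((2 * m + 1) choose m) = (fact (2 * m + 1) :: nat)"
    using binomial_fact_lemma[of m "2 * m + 1"] by simp
  moreover have "p dvd (fact (2 * m + 1) :: nat)"
    using assms by (simp add: prime_dvd_fact_iff del: fact_Suc)
  moreover have "\<not> p dvd (fact m :: nat)" "\<not> p dvd (fact (m + 1) :: nat)"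
    using assms by (simp_all add: prime_dvd_fact_iff del: fact_Suc)
  ultimately show ?thesis
    using assms(1) by (metis prime_dvd_mult_iff)
qed

text \<open>
  For odd \<open>n = 2 * m + 1\<close> the primes above \<open>m + 1\<close> all divide a binomial coefficient that is at
  most \<open>4 ^ m\<close>, and the remaining ones are covered by the induction hypothesis for \<open>m + 1\<close>. Even
  \<open>n > 2\<close> bring in no prime beyond those up to \<open>n - 1\<close>.
\<close>
lemma primorial_le: "\<Prod>{p::nat. prime p \<and> p \<le> n} \<le> (4::nat) ^ n"
proof (induction n rule: less_induct)
  case (less n)
  consider "n \<le> 1" | "n = 2" | "n > 2" "even n" | m where "n = 2 * m + 1" "m \<ge> 1"
  proof (cases "even n")
    case False
    then obtain m where "n = 2 * m + 1" by (elim oddE)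
    then show ?thesis using that(1) that(4)[of m] by (cases "m = 0") auto
  qed (use that in linarith)
  then show ?case
  proof cases
    case 1
    then have "{p::nat. prime p \<and> p \<le> n} = {}"
      by (auto dest: prime_gt_1_nat)
    then show ?thesis by (simp only: prod.empty) simp
  next
    case 2
    have "{p::nat. prime p \<and> p \<le> 2} = {2}"
      by (auto dest: prime_ge_2_nat)
    with 2 show ?thesis by simp
  next
    case 3
    have "{p::nat. prime p \<and> p \<le> n} = {p::nat. prime p \<and> p \<le> n - 1}"
    proof -
      have "\<not> prime n" using 3 prime_odd_nat by blast
      then show ?thesis by (auto simp: le_less)
    qed
    also have "\<Prod>\<dots> \<le> 4 ^ (n - 1)" using less[of "n - 1"] 3 by simp
    also have "\<dots> \<le> 4 ^ n" by (intro power_increasing) auto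
    finally show ?thesis .
  next
    case 4
    let ?L = "{p::nat. prime p \<and> p \<le> m + 1}" and ?U = "{p::nat. prime p \<and> m + 1 < p \<and> p \<le> n}"
    have "\<Prod>?U dvd (2 * m + 1) choose m"
      using 4 by (intro prod_primes_dvd prime_dvd_odd_central_binomial) auto
    then have "\<Prod>?U \<le> (2 * m + 1) choose m"
      by (rule dvd_imp_le) (simp add: zero_less_binomial_iff)
    also have "\<dots> \<le> 4 ^ m" by (rule odd_central_binomial_le)
    finally have U: "\<Prod>?U \<le> 4 ^ m" .
    have "{p::nat. prime p \<and> p \<le> n} = ?L \<union> ?U" using 4 by auto
    then have "\<Prod>{p::nat. prime p \<and> p \<le> n} = \<Prod>?L * \<Prod>?U"
      by (simp add: prod.union_disjoint disjoint_iff)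
    also have "\<dots> \<le> 4 ^ (m + 1) * 4 ^ m"
      using less[of "m + 1"] 4 U by (intro mult_mono) auto
    also have "\<dots> = 4 ^ n" using 4 by (simp add: mult_2 power_add)
    finally show ?thesis .
  qed
qed

lemma le_floor_sqrt:
  assumes "x ^ 2 \<le> (n::nat)"
  shows "x \<le> nat \<lfloor>sqrt n\<rfloor>"
proof -
  have "real x ^ 2 \<le> real n" using assms by (metis of_nat_le_iff of_nat_power)
  then show ?thesis by (intro le_nat_floor real_le_rsqrt)
qed

lemma card_primes_square_le:
  "real (card {p::nat. prime p \<and> p ^ 2 \<le> n}) \<le> sqrt n"
proof -
  have "{p::nat. prime p \<and> p ^ 2 \<le> n} \<subseteq> {1..nat \<lfloor>sqrt n\<rfloor>}"
    using le_floor_sqrt prime_ge_1_nat by auto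
  then have "card {p::nat. prime p \<and> p ^ 2 \<le> n} \<le> card {1..nat \<lfloor>sqrt n\<rfloor>}"
    by (intro card_mono) simp
  then have "card {p::nat. prime p \<and> p ^ 2 \<le> n} \<le> nat \<lfloor>sqrt n\<rfloor>" by simp
  moreover have "real (nat \<lfloor>sqrt n\<rfloor>) \<le> sqrt n"
    by (intro of_nat_floor) simp
  ultimately show ?thesis by linarith
qed

text \<open>
  Each of these primes contributes more than \<open>sqrt n\<close> to the product of all primes up to \<open>n\<close>, so
  the square of that product, which is at most \<open>(4 ^ n) ^ 2\<close>, dominates the left-hand side.
\<close>
lemma power_card_large_primes_le:
  "n ^ card {p::nat. prime p \<and> p \<le> n \<and> n < p ^ 2} \<le> 16 ^ n"
proof -
  let ?L = "{p::nat. prime p \<and> p \<le> n \<and> n < p ^ 2}"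
  have "\<Prod>?L dvd \<Prod>{p::nat. prime p \<and> p \<le> n}"
    by (intro prod_dvd_prod_subset) auto
  moreover have "\<Prod>{p::nat. prime p \<and> p \<le> n} > 0"
    by (intro prod_pos) (auto simp: prime_gt_0_nat)
  ultimately have "\<Prod>?L \<le> \<Prod>{p::nat. prime p \<and> p \<le> n}" by (rule dvd_imp_le)
  also have "\<dots> \<le> 4 ^ n" by (rule primorial_le)
  finally have L: "\<Prod>?L \<le> 4 ^ n" .
  have "n ^ card ?L = (\<Prod>p\<in>?L. n)" by simp
  also have "\<dots> \<le> (\<Prod>p\<in>?L. p ^ 2)" by (intro prod_mono) auto
  also have "\<dots> = (\<Prod>?L) ^ 2" by (simp add: prod_power_distrib)
  also have "\<dots> \<le> (4 ^ n) ^ 2" using L by (rule power_mono) simp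
  also have "\<dots> = 16 ^ n" by (simp add: power2_eq_square flip: power_mult_distrib)
  finally show ?thesis .
qed

lemma card_large_primes_le:
  assumes "n \<ge> 2"
  shows "real (card {p::nat. prime p \<and> p \<le> n \<and> n < p ^ 2}) \<le> n * ln 16 / ln n"
proof -
  let ?k = "card {p::nat. prime p \<and> p \<le> n \<and> n < p ^ 2}"
  have "real (n ^ ?k) \<le> real (16 ^ n)"
    by (simp only: of_nat_le_iff power_card_large_primes_le)
  then have "ln (real n ^ ?k) \<le> ln (16 ^ n)"
    using assms by (subst ln_le_cancel_iff) auto
  then have "?k * ln n \<le> n * ln 16"
    using assms by (simp add: ln_realpow)
  then show ?thesis using assms by (simp add: field_simps)
qed

lemma prime_count_le:
  fixes n :: nat
  assumes "n \<ge> 2"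
  shows "real (card {p::nat. prime p \<and> p \<le> n}) \<le> sqrt n + n * ln 16 / ln n"
proof -
  let ?S = "{p::nat. prime p \<and> p ^ 2 \<le> n}"
  let ?L = "{p::nat. prime p \<and> p \<le> n \<and> n < p ^ 2}"
  have "finite ?S" by (rule finite_subset[of _ "{..n}"]) (auto intro: power2_nat_le_imp_le)
  moreover have "{p::nat. prime p \<and> p \<le> n} \<subseteq> ?S \<union> ?L" by auto
  ultimately have "card {p::nat. prime p \<and> p \<le> n} \<le> card (?S \<union> ?L)"
    by (intro card_mono) auto
  also have "\<dots> \<le> card ?S + card ?L" by (rule card_Un_le)
  finally show ?thesis
    using card_primes_square_le[of n] card_large_primes_le[OF assms] by linarith
qed

section \<open>Pairs below the smallest prime divisor of their sum\<close>

text \<open>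
  The cofactor of the smallest prime divisor is not \<open>1\<close>, so it has a prime divisor of its own, and
  this is at least as large.
\<close>
lemma smallest_prime_divisor_square_le:
  assumes "m \<ge> 2" "\<not> prime m"
  shows "smallest_prime_divisor m ^ 2 \<le> m"
proof -
  let ?p = "smallest_prime_divisor m"
  have "\<exists>p. prime p \<and> p dvd m" using assms by (intro prime_factor_nat) auto
  then have "prime ?p \<and> ?p dvd m"
    unfolding smallest_prime_divisor_def by (rule LeastI_ex)
  then have p: "prime ?p" "?p dvd m" by auto
  then obtain k where k: "m = ?p * k" by (elim dvdE)
  have "k \<noteq> 1"
  proof
    assume "k = 1"
    with k have "m = ?p" by simp
    with p(1) assms(2) show False by simp
  qed
  then obtain q where q: "prime q" "q dvd k" using prime_factor_nat by blast
  have "q dvd m" using q(2) k by (metis dvd_mult)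
  then have "?p \<le> q"
    unfolding smallest_prime_divisor_def using q(1) by (intro Least_le) auto
  also have "q \<le> k" using q(2) k assms(1) by (intro dvd_imp_le) (auto intro: gr0I)
  finally have "?p * ?p \<le> ?p * k" by simp
  with k show ?thesis by (simp add: power2_eq_square)
qed

text \<open>
  The first summand accounts for the pairs with prime sum, encoded by the first entry and the sum;
  the second for those with composite sum, where one of the entries is at most \<open>sqrt n\<close>.
\<close>
lemma card_non_exceeding_pairs_le:
  "real (card (non_exceeding_pairs n)) \<le>
     real n * real (card {p::nat. prime p \<and> p \<le> n}) + 2 * (n * sqrt n)"
proof -
  let ?P = "{p::nat. prime p \<and> p \<le> n}" and ?s = "nat \<lfloor>sqrt n\<rfloor>"
  let ?A = "(\<lambda>(a, p). (a, p - a)) ` ({1..n} \<times> ?P)"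
  let ?C = "{1..?s} \<times> {1..n} \<union> {1..n} \<times> {1..?s}"
  have sub: "non_exceeding_pairs n \<subseteq> ?A \<union> ?C"
  proof (rule subrelI, rule UnCI)
    fix a b assume ab: "(a, b) \<in> non_exceeding_pairs n" "(a, b) \<notin> ?C"
    from ab(1) have n: "0 < a" "0 < b" "a + b \<le> n"
      and m: "min a b < smallest_prime_divisor (a + b)"
      by (simp_all add: non_exceeding_pairs_def)
    have "prime (a + b)"
    proof (rule ccontr)
      assume "\<not> prime (a + b)"
      then have "smallest_prime_divisor (a + b) ^ 2 \<le> a + b"
        using n by (intro smallest_prime_divisor_square_le) auto
      moreover have "min a b ^ 2 \<le> smallest_prime_divisor (a + b) ^ 2"
        using m by (intro power_mono) auto
      ultimately have "min a b \<le> ?s" using n by (intro le_floor_sqrt) linarith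
      with ab(2) n show False by (auto simp: min_def split: if_splits)
    qed
    then show "(a, b) \<in> ?A" using n by (intro image_eqI[of _ _ "(a, a + b)"]) auto
  qed
  have fin: "finite (?A \<union> ?C)" by simp
  have "card (non_exceeding_pairs n) \<le> card (?A \<union> ?C)" using fin sub by (rule card_mono)
  also have "\<dots> \<le> card ?A + (card ({1..?s} \<times> {1..n}) + card ({1..n} \<times> {1..?s}))"
    by (intro order_trans[OF card_Un_le] add_mono card_Un_le order_refl)
  also have "\<dots> \<le> n * card ?P + (?s * n + n * ?s)"
    using card_image_le[of "{1..n} \<times> ?P" "\<lambda>(a, p). (a, p - a)"]
    by (simp add: card_cartesian_product)
  finally have "real (card (non_exceeding_pairs n)) \<le> real (n * card ?P + (?s * n + n * ?s))"
    by (simp only: of_nat_le_iff)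
  also have "\<dots> = real n * real (card ?P) + 2 * (n * real ?s)" by simp
  also have "\<dots> \<le> real n * real (card ?P) + 2 * (n * sqrt n)"
    by (intro add_left_mono mult_left_mono of_nat_floor) auto
  finally show "real (card (non_exceeding_pairs n)) \<le> real n * real (card ?P) + 2 * (n * sqrt n)" .
qed

lemma non_exceeding_pairs_density_zero:
  "(\<lambda>n. real (card (non_exceeding_pairs n)) / real n ^ 2) \<longlonglongrightarrow> 0"
proof (rule tendsto_sandwich[where f = "\<lambda>_. 0"])
  let ?g = "\<lambda>n::nat. 3 / sqrt (real n) + ln 16 / ln (real n)"
  show "\<forall>\<^sub>F n in sequentially. real (card (non_exceeding_pairs n)) / real n ^ 2 \<le> ?g n"
    using eventually_ge_at_top[of 2]
  proof eventually_elim
    case (elim n)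
    have "real (card (non_exceeding_pairs n))
            \<le> real n * real (card {p::nat. prime p \<and> p \<le> n}) + 2 * (n * sqrt n)"
      by (rule card_non_exceeding_pairs_le)
    also have "\<dots> \<le> n * (sqrt n + n * ln 16 / ln n) + 2 * (n * sqrt n)"
      by (intro add_right_mono mult_left_mono prime_count_le elim) simp
    also have "\<dots> = 3 * (real n * sqrt n) + real n ^ 2 * (ln 16 / ln n)"
      by (simp add: algebra_simps power2_eq_square)
    also have "real n * sqrt n = real n ^ 2 / sqrt n"
      using elim by (simp add: field_simps power2_eq_square)
    also have "3 * (real n ^ 2 / sqrt n) + real n ^ 2 * (ln 16 / ln n) = ?g n * real n ^ 2"
      by (simp add: algebra_simps)
    finally have "real (card (non_exceeding_pairs n)) \<le> ?g n * real n ^ 2" .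
    moreover have "0 < real n ^ 2" using elim by simp
    ultimately show ?case by (subst pos_divide_le_eq)
  qed
  have "filterlim (\<lambda>n. sqrt (real n)) at_infinity sequentially"
    by (intro filterlim_at_top_imp_at_infinity filterlim_compose[OF sqrt_at_top]
        filterlim_real_sequentially)
  moreover have "filterlim (\<lambda>n. ln (real n)) at_infinity sequentially"
    by (intro filterlim_at_top_imp_at_infinity filterlim_compose[OF ln_at_top]
        filterlim_real_sequentially)
  ultimately have "?g \<longlonglongrightarrow> 0 + 0"
    by (intro tendsto_add tendsto_divide_0[OF tendsto_const])
  then show "?g \<longlonglongrightarrow> 0" by simp
qed auto

section \<open>Passage to the limit\<close>

theorem corollary4p23:
  fixes N :: nat
  assumes "3 \<le> N"
  shows "(\<lambda>n. real (card {l \<in> flag_types_upto N n. admits_non_exceeding l})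
              / real (card (flag_types_upto N n))) \<longlonglongrightarrow> 0"
proof (rule tendsto_sandwich[where f = "\<lambda>_. 0"])
  let ?h = "\<lambda>n. real (N - 1) * (2 * real N) ^ N
                  * (real (card (non_exceeding_pairs n)) / real n ^ 2)"
  have "2 \<le> N" using assms by simp
  then show "\<forall>\<^sub>F n in sequentially. real (card {l \<in> flag_types_upto N n. admits_non_exceeding l})
      / real (card (flag_types_upto N n)) \<le> ?h n"
    by (intro eventually_sequentiallyI[of N] admits_non_exceeding_ratio_le)
  show "?h \<longlonglongrightarrow> 0"
    by (intro tendsto_mult_right_zero non_exceeding_pairs_density_zero)
qed auto

end
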